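(* Let $\delta>0$ be fixed, sufficiently small. There exist constants $\bar s,\bar r>0$ such that, for all sufficiently large $L$, if $\nu^-$ is stationary for the inverse projective process, then $$\nu^-\Bigl\{(x,y,\theta):\theta\notin B_{L^{-\bar s}}\left(\tfrac{\pi}{2}\right)\Bigr\}\le L^{-\bar r}.$$
   Context: For $L>0$ and $\delta>0$ put $\sigma:=L^{-\delta}$ and $f(x):=L\cos(2\pi x)$; $(\omega_i)_{i\ge0}$ are i.i.d. uniform on $[-\sigma,\sigma]$, and $f_{\omega_i}(x,y)=(f(x+\omega_i)-y,\;x+\omega_i)\pmod1$ on $\mathbb T^2$. A direction in $\mathbb P^1$ is represented by the unique angle $\theta\in[0,\pi)$ with $v=(\cos\theta,\sin\theta)$ up to sign (so $\theta=\pi/2$ is vertical); $B_r(\theta_0)$ is the ball of radius $r$ about $\theta_0$ in $\mathbb P^1$. $\mathbb{PT}^2\simeq\mathbb T^2\times\mathbb P^1$. The inverse projective process is the Markov chain on $\mathbb{PT}^2$ induced by the inverse maps $f_{\omega_i}^{-1}$ and their derivatives: $$x_{i+1}=y_i-\omega_i,\qquad y_{i+1}=f(y_i)-x_i\pmod1,\qquad\tan\theta_{i+1}=f'(y_i)-\cot\theta_i .$$ A stationary measure is a probability measure on $\mathbb{PT}^2$ invariant under the transition kernel of this chain. *)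

theory Defs
  imports "HOL-Probability.Probability"
begin

definition kick :: "real \<Rightarrow> real \<Rightarrow> real" where
  "kick L x = L * cos (2 * pi * x)"

text \<open>
  The circle \<open>\<real>/\<int>\<close> is represented by its fundamental domain \<open>[0,1)\<close>, with reduction modulo 1
  given by \<^const>\<open>frac\<close>, and the projective line by angles in \<open>[0,\<pi>)\<close>.  The Borel sets of
  these half-open intervals are exactly the Borel sets of the corresponding compact quotients.
\<close>

definition torus :: "(real \<times> real) set" where
  "torus = {0..<1} \<times> {0..<1}"

definition perturbed_map :: "real \<Rightarrow> real \<Rightarrow> real \<times> real \<Rightarrow> real \<times> real" where
  "perturbed_map L w = (\<lambda>(x, y). (frac (kick L (x + w) - y), frac (x + w)))"

definition perturbed_map_inv :: "real \<Rightarrow> real \<Rightarrow> real \<times> real \<Rightarrow> real \<times> real" where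
  "perturbed_map_inv L w = (\<lambda>(x, y). (frac (y - w), frac (kick L y - x)))"

definition perturbed_map_inv_deriv :: "real \<Rightarrow> real \<times> real \<Rightarrow> real \<times> real \<Rightarrow> real \<times> real" where
  "perturbed_map_inv_deriv L = (\<lambda>(x, y) (u, v). (v, deriv (kick L) y * v - u))"

text \<open>The angle in \<open>[0,\<pi>)\<close> of the line spanned by a nonzero vector.\<close>

definition line_angle :: "real \<times> real \<Rightarrow> real" where
  "line_angle v = (THE t. t \<in> {0..<pi} \<and> (\<exists>c. c \<noteq> 0 \<and> v = c *\<^sub>R (cos t, sin t)))"

definition proj_dist :: "real \<Rightarrow> real \<Rightarrow> real" where
  "proj_dist s t = min \<bar>s - t\<bar> (pi - \<bar>s - t\<bar>)"

definition proj_ball :: "real \<Rightarrow> real \<Rightarrow> real set" where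
  "proj_ball r t = {s \<in> {0..<pi}. proj_dist s t < r}"

definition proj_bundle :: "(real \<times> real \<times> real) measure" where
  "proj_bundle = restrict_space borel ({0..<1} \<times> {0..<1} \<times> {0..<pi})"

definition inv_proj_step :: "real \<Rightarrow> real \<Rightarrow> real \<times> real \<times> real \<Rightarrow> real \<times> real \<times> real" where
  "inv_proj_step L w = (\<lambda>(x, y, t).
     let (x', y') = perturbed_map_inv L w (x, y)
     in (x', y', line_angle (perturbed_map_inv_deriv L (x, y) (cos t, sin t))))"

definition noise :: "real \<Rightarrow> real \<Rightarrow> real measure" where
  "noise \<delta> L = uniform_measure lborel {- (L powr (-\<delta>)) .. L powr (-\<delta>)}"

definition inv_proj_kernel ::
    "real \<Rightarrow> real \<Rightarrow> real \<times> real \<times> real \<Rightarrow> (real \<times> real \<times> real) measure" where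
  "inv_proj_kernel \<delta> L z = distr (noise \<delta> L) proj_bundle (\<lambda>w. inv_proj_step L w z)"

definition stationary_inv_proj ::
    "real \<Rightarrow> real \<Rightarrow> (real \<times> real \<times> real) measure \<Rightarrow> bool" where
  "stationary_inv_proj \<delta> L \<nu> \<longleftrightarrow>
     prob_space \<nu> \<and> sets \<nu> = sets proj_bundle \<and>
     (\<forall>A \<in> sets proj_bundle. emeasure \<nu> A = (\<integral>\<^sup>+ z. emeasure (inv_proj_kernel \<delta> L z) A \<partial>\<nu>))"

text \<open>
  Sanity checks: \<^const>\<open>perturbed_map_inv\<close> is the inverse of \<^const>\<open>perturbed_map\<close>, its lift to
  the plane has derivative \<^const>\<open>perturbed_map_inv_deriv\<close>, and the induced action on angles is
  \<open>tan t' = f' y - cot t\<close>, where \<open>cot 0 = \<infinity>\<close> is read as \<open>t' = \<pi>/2\<close>.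
\<close>


lemma frac_diff_frac: "frac (a - frac b) = frac (a - b)"
proof -
  have "a - frac b = (a - b) + of_int \<lfloor>b\<rfloor>" by (simp add: frac_def)
  moreover have "frac ((a - b) + of_int \<lfloor>b\<rfloor>) = frac (a - b)"
    unfolding frac_def by (simp add: floor_add_int[symmetric])
  ultimately show ?thesis by (simp only:)
qed

lemma frac_frac_add: "frac (frac a + b) = frac (a + b)"
proof -
  have "frac a + b = (a + b) + of_int (- \<lfloor>a\<rfloor>)" by (simp add: frac_def)
  then show ?thesis by (simp only: frac_def floor_add_int) simp
qed

lemma kick_frac: "kick L (frac x) = kick L x"
proof -
  have "2 * pi * frac x = 2 * pi * x - 2 * pi * of_int \<lfloor>x\<rfloor>"
    by (simp add: frac_def right_diff_distrib)
  then show ?thesis by (simp add: kick_def cos_diff)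
qed

lemma perturbed_map_inv_left:
  assumes "p \<in> torus"
  shows "perturbed_map_inv L w (perturbed_map L w p) = p"
proof -
  obtain x y where p: "p = (x, y)" "x \<in> {0..<1}" "y \<in> {0..<1}"
    using assms by (auto simp: torus_def)
  have "frac (frac (x + w) - w) = x"
    using frac_frac_add[of "x + w" "- w"] p(2) by (simp add: frac_eq)
  then show ?thesis
    using p(3) by (simp add: p(1) perturbed_map_def perturbed_map_inv_def kick_frac
        frac_diff_frac frac_eq)
qed

lemma perturbed_map_inv_right:
  assumes "p \<in> torus"
  shows "perturbed_map L w (perturbed_map_inv L w p) = p"
proof -
  obtain x y where p: "p = (x, y)" "x \<in> {0..<1}" "y \<in> {0..<1}"
    using assms by (auto simp: torus_def)
  have *: "frac (frac (y - w) + w) = y"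
    using frac_frac_add[of "y - w" w] p(3) by (simp add: frac_eq)
  have "kick L (frac (y - w) + w) = kick L y"
    using * kick_frac[of L "frac (y - w) + w"] by simp
  then show ?thesis
    using * p(2) by (simp add: p(1) perturbed_map_def perturbed_map_inv_def
        frac_diff_frac frac_eq)
qed

lemma kick_deriv: "(kick L has_field_derivative deriv (kick L) y) (at y)"
proof -
  have "(kick L has_field_derivative L * (- sin (2 * pi * y) * (2 * pi))) (at y)"
    unfolding kick_def by (auto intro!: derivative_eq_intros)
  then show ?thesis by (simp add: DERIV_imp_deriv)
qed

lemma perturbed_map_inv_deriv:
  "((\<lambda>(x, y). (y - w, kick L y - x)) has_derivative perturbed_map_inv_deriv L p) (at p)"
proof -
  obtain x y where p: "p = (x, y)" by force
  have k: "((\<lambda>q. kick L (snd q)) has_derivative (\<lambda>h. deriv (kick L) y * snd h)) (at p)"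
    using has_derivative_compose[of snd snd p UNIV "kick L" "\<lambda>h. deriv (kick L) y * h"]
      kick_deriv[of L y] by (simp add: p has_field_derivative_def has_derivative_snd)
  have "((\<lambda>q. (snd q - w, kick L (snd q) - fst q)) has_derivative
          (\<lambda>h. (snd h, deriv (kick L) y * snd h - fst h))) (at p)"
    by (auto intro!: derivative_eq_intros k)
  then show ?thesis
    by (simp add: p perturbed_map_inv_deriv_def case_prod_unfold)
qed

lemma line_angle_eq:
  assumes "t \<in> {0..<pi}" "c \<noteq> 0"
  shows "line_angle (c *\<^sub>R (cos t, sin t)) = t"
  unfolding line_angle_def
proof (rule the_equality)
  show "t \<in> {0..<pi} \<and> (\<exists>d. d \<noteq> 0 \<and> c *\<^sub>R (cos t, sin t) = d *\<^sub>R (cos t, sin t))"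
    using assms by auto
next
  fix u
  assume u: "u \<in> {0..<pi} \<and> (\<exists>d. d \<noteq> 0 \<and> c *\<^sub>R (cos t, sin t) = d *\<^sub>R (cos u, sin u))"
  then obtain d where d: "d \<noteq> 0" "c * cos t = d * cos u" "c * sin t = d * sin u" by auto
  have "c * sin (t - u) = (c * sin t) * cos u - (c * cos t) * sin u"
    by (simp add: sin_diff algebra_simps)
  also have "\<dots> = 0" by (simp add: d)
  finally have s: "sin (t - u) = 0" using assms by simp
  show "u = t"
  proof (rule ccontr)
    assume "u \<noteq> t"
    then consider "0 < t - u" "t - u < pi" | "0 < u - t" "u - t < pi"
      using u assms by force
    then show False
    proof cases
      case 1 then show False using s sin_gt_zero[of "t - u"] by simp
    next
      case 2 then show False using s sin_gt_zero[of "u - t"] sin_minus[of "t - u"] by simp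
    qed
  qed
qed

lemma line_angle_exists:
  assumes "v \<noteq> 0"
  shows "line_angle v \<in> {0..<pi} \<and>
    (\<exists>c. c \<noteq> 0 \<and> v = c *\<^sub>R (cos (line_angle v), sin (line_angle v)))"
proof -
  obtain a b where v: "v = (a, b)" by force
  define r where "r = norm (Complex a b)"
  define \<phi> where "\<phi> = Arg2pi (Complex a b)"
  have r: "r \<noteq> 0" using assms by (auto simp: r_def v complex_eq_iff zero_prod_def)
  have "Complex a b = of_real r * exp (\<i> * of_real \<phi>)"
    using Arg2pi[of "Complex a b"] by (simp add: r_def \<phi>_def is_Arg_def)
  then have ab: "a = r * cos \<phi>" "b = r * sin \<phi>"
    by (simp_all add: complex_eq_iff Re_exp Im_exp)
  have \<phi>: "0 \<le> \<phi>" "\<phi> < 2 * pi" using Arg2pi[of "Complex a b"] by (auto simp: \<phi>_def)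
  have "\<exists>t c. t \<in> {0..<pi} \<and> c \<noteq> 0 \<and> v = c *\<^sub>R (cos t, sin t)"
  proof (cases "\<phi> < pi")
    case True then show ?thesis using \<phi> r ab v by (intro exI[of _ \<phi>] exI[of _ r]) auto
  next
    case False
    then show ?thesis using \<phi> r ab v
      by (intro exI[of _ "\<phi> - pi"] exI[of _ "-r"]) (auto simp: cos_diff sin_diff)
  qed
  then show ?thesis using line_angle_eq by auto
qed

lemma inv_proj_step_horizontal:
  "inv_proj_step L w (x, y, 0) = (frac (y - w), frac (kick L y - x), pi / 2)"
  using line_angle_eq[of "pi / 2" "-1"]
  by (simp add: inv_proj_step_def perturbed_map_inv_def perturbed_map_inv_deriv_def)

lemma inv_proj_step_tan:
  assumes "t \<in> {0<..<pi}"
  shows "\<exists>t'. inv_proj_step L w (x, y, t) = (frac (y - w), frac (kick L y - x), t') \<and>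
    t' \<in> {0..<pi} \<and> cos t' \<noteq> 0 \<and> tan t' = deriv (kick L) y - cot t"
proof -
  have s: "sin t > 0" using assms by (simp add: sin_gt_zero)
  define v where "v = perturbed_map_inv_deriv L (x, y) (cos t, sin t)"
  have v: "v = (sin t, deriv (kick L) y * sin t - cos t)"
    by (simp add: v_def perturbed_map_inv_deriv_def)
  have "v \<noteq> 0" using s by (simp add: v zero_prod_def)
  then obtain c where c: "c \<noteq> 0" "v = c *\<^sub>R (cos (line_angle v), sin (line_angle v))"
    and u: "line_angle v \<in> {0..<pi}"
    using line_angle_exists by blast
  define t' where "t' = line_angle v"
  have e: "sin t = c * cos t'" "deriv (kick L) y * sin t - cos t = c * sin t'"
    using c(2)[folded t'_def] by (auto simp: v)
  have ct: "cos t' \<noteq> 0" using e s by auto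
  have "tan t' = (c * sin t') / (c * cos t')" using c by (simp add: tan_def)
  also have "\<dots> = deriv (kick L) y - cot t"
    unfolding e[symmetric] using s by (simp add: cot_def diff_divide_distrib)
  finally show ?thesis
    using u ct by (auto simp: inv_proj_step_def perturbed_map_inv_def v_def[symmetric] t'_def)
qed

lemma prob_space_inv_proj_kernel:
  assumes "L > 0" "z \<in> space proj_bundle"
  shows "prob_space (inv_proj_kernel \<delta> L z)"
proof -
  obtain x y t where z: "z = (x, y, t)" and t: "t \<in> {0..<pi}"
    using assms(2) by (auto simp: proj_bundle_def space_restrict_space)
  have "prob_space (noise \<delta> L)"
    unfolding noise_def using assms(1) by (intro prob_space_uniform_measure) auto
  moreover have "(\<lambda>w. inv_proj_step L w z) \<in> measurable (noise \<delta> L) proj_bundle"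
  proof -
    have "perturbed_map_inv_deriv L (x, y) (cos t, sin t) \<noteq> 0"
    proof
      assume "perturbed_map_inv_deriv L (x, y) (cos t, sin t) = 0"
      then have "sin t = 0" "cos t = 0" by (auto simp: perturbed_map_inv_deriv_def zero_prod_def)
      then show False using sin_cos_squared_add[of t] by simp
    qed
    then obtain u where u: "u \<in> {0..<pi}"
      "\<And>w. inv_proj_step L w z = (frac (y - w), frac (kick L y - x), u)"
      using line_angle_exists[of "perturbed_map_inv_deriv L (x, y) (cos t, sin t)"]
      by (auto simp: z inv_proj_step_def perturbed_map_inv_def)
    have "(\<lambda>w. frac (y - w)) \<in> borel_measurable borel"
      unfolding frac_def by measurable
    then have "(\<lambda>w. (frac (y - w), frac (kick L y - x), u)) \<in> borel_measurable borel"
      by (intro borel_measurable_Pair) auto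
    then show ?thesis
      using u by (auto simp: proj_bundle_def noise_def frac_lt_1 intro!: measurable_restrict_space2)
  qed
  ultimately show ?thesis
    unfolding inv_proj_kernel_def by (rule prob_space.prob_space_distr)
qed

end

theory Submission
  imports Defs "HOL-Real_Asymp.Real_Asymp"
begin

text \<open>
  The coordinate \<open>y\<^sub>i\<^sub>+\<^sub>2 = f(y\<^sub>i\<^sub>+\<^sub>1) - y\<^sub>i + \<omega>\<^sub>i\<close> is, given the state at time \<open>i\<close>, uniform on an arc of
  length \<open>2\<sigma>\<close>, whereas \<open>\<theta>\<^sub>i\<^sub>+\<^sub>2\<close> is a function of that state alone.  Hence
  \<open>tan \<theta>\<^sub>i\<^sub>+\<^sub>3 = f'(y\<^sub>i\<^sub>+\<^sub>2) - cot \<theta>\<^sub>i\<^sub>+\<^sub>2\<close> is at most \<open>M\<close> in absolute value only if \<open>y\<^sub>i\<^sub>+\<^sub>2\<close> lies in a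
  sublevel set \<open>\<bar>sin(2\<pi>y) - b\<bar> \<le> M/(2\<pi>L)\<close> with \<open>b\<close> fixed.  The critical points of the sine are
  nondegenerate, so this has probability \<open>O(\<surd>(M/L) / \<sigma>)\<close>.
\<close>

section \<open>Sublevel sets of the sine\<close>

text \<open>The difference of the two sides vanishes at 0 and has derivative
  \<open>x * sin x\<close>. This is \<open>h \<le> tan h\<close> without the division, so it makes
  sense at pi/2 as well. It serves twice: for the lower bound on the sine, and for comparing an
  angle with its slope.\<close>

lemma mult_cos_le_sin:
  fixes h :: real
  assumes "0 \<le> h" "h \<le> pi"
  shows "h * cos h \<le> sin h"
proof -
  have "sin 0 - 0 * cos 0 \<le> sin h - h * cos h"
  proof (rule DERIV_nonneg_imp_nondecreasing[OF assms(1)])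
    fix x assume x: "0 \<le> x" "x \<le> h"
    have "((\<lambda>x. sin x - x * cos x) has_real_derivative x * sin x) (at x)"
      by (auto intro!: derivative_eq_intros)
    moreover have "x * sin x \<ge> 0" using x assms by (auto intro!: mult_nonneg_nonneg sin_ge_zero)
    ultimately show "\<exists>d. ((\<lambda>x. sin x - x * cos x) has_real_derivative d) (at x) \<and> 0 \<le> d" by blast
  qed
  then show ?thesis by simp
qed

text \<open>Squaring \<open>h * cos h \<le> sin h\<close> and eliminating the cosine leaves the
  factor \<open>1 + h\<^sup>2\<close>, bounded because h is below 2. Any constant would serve; 9 is
  a convenient square.\<close>

lemma le_3_mult_sin:
  fixes h :: real
  assumes "0 \<le> h" "h \<le> pi / 2"
  shows "h \<le> 3 * sin h"
proof -
  have s: "sin h \<ge> 0" "cos h \<ge> 0"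
    using assms by (auto intro!: sin_ge_zero cos_ge_zero)
  have "h * cos h \<le> sin h" using mult_cos_le_sin assms by simp
  then have "(h * cos h)\<^sup>2 \<le> (sin h)\<^sup>2" using s assms by (intro power_mono) auto
  then have "h\<^sup>2 \<le> (1 + h\<^sup>2) * (sin h)\<^sup>2"
    by (simp add: cos_squared_eq algebra_simps)
  also have "\<dots> \<le> 9 * (sin h)\<^sup>2"
  proof (rule mult_right_mono)
    have "h\<^sup>2 \<le> 2\<^sup>2" using assms pi_half_less_two by (intro power_mono) auto
    then show "1 + h\<^sup>2 \<le> 9" by simp
  qed simp
  finally have "h\<^sup>2 \<le> (3 * sin h)\<^sup>2" by (simp add: power_mult_distrib)
  then show ?thesis by (rule power2_le_imp_le) (use s in simp)
qed

lemma abs_cos_diff_int_pi: "\<bar>cos (x - pi * of_int k)\<bar> = \<bar>cos x\<bar>"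
proof -
  have "(cos (pi * of_int k))\<^sup>2 = 1"
    using sin_cos_squared_add[of "pi * of_int k"] by simp
  then have "\<bar>cos (pi * of_int k :: real)\<bar> = 1" by (simp add: power2_eq_1_iff abs_if)
  then show ?thesis by (simp add: cos_diff abs_mult)
qed

text \<open>Both points lie on one monotone branch of the sine. With half-distance h and midpoint m,
  the increment is \<open>2 * sin h * \<bar>cos m\<bar>\<close>. The midpoint is at distance at
  least h from the ends of the branch, where the cosine vanishes, so
  \<open>\<bar>cos m\<bar> \<ge> sin h\<close> and the increment is at least
  \<open>2 * h\<^sup>2 / 9\<close>. The square root is the price of the critical points at those
  ends.\<close>

lemma sin_sublevel_diameter:
  fixes p q b \<epsilon> :: real
  assumes "\<bar>p - pi * of_int k\<bar> \<le> pi / 2" "\<bar>q - pi * of_int k\<bar> \<le> pi / 2"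
    and "\<bar>sin p - b\<bar> \<le> \<epsilon>" "\<bar>sin q - b\<bar> \<le> \<epsilon>"
  shows "\<bar>q - p\<bar> \<le> 6 * sqrt \<epsilon>"
  using assms
proof (induction p q rule: linorder_wlog)
  case (le p q)
  define h where "h = (q - p) / 2"
  define m where "m = (q + p) / 2"
  have "p \<ge> pi * of_int k - pi / 2" "q \<le> pi * of_int k + pi / 2"
    using le(2,3) unfolding abs_le_iff by (simp_all add: algebra_simps)
  then have "q - p \<le> pi" by linarith
  then have h: "0 \<le> h" "h \<le> pi / 2" using le(1) unfolding h_def by simp_all
  have m: "\<bar>m - pi * of_int k\<bar> \<le> pi / 2 - h"
    using le(1-3) unfolding h_def m_def abs_le_iff by (simp add: field_simps; linarith)
  have "sin h = cos (pi / 2 - h)" by (simp add: cos_diff)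
  also have "\<dots> \<le> cos \<bar>m - pi * of_int k\<bar>" using m h by (intro cos_monotone_0_pi_le) auto
  also have "\<dots> \<le> \<bar>cos m\<bar>" using abs_cos_diff_int_pi[of m k] by simp
  finally have sc: "sin h \<le> \<bar>cos m\<bar>" .
  have sh: "sin h \<ge> 0" using h by (intro sin_ge_zero) auto
  have "h\<^sup>2 \<le> (3 * sin h)\<^sup>2" using le_3_mult_sin h by (intro power_mono) auto
  also have "\<dots> = 9 * (sin h * sin h)" by (simp add: power2_eq_square)
  also have "\<dots> \<le> 9 * (sin h * \<bar>cos m\<bar>)" using sc sh by (intro mult_left_mono) auto
  also have "2 * (sin h * \<bar>cos m\<bar>) = \<bar>sin q - sin p\<bar>"
    using sh by (simp add: sin_diff_sin h_def m_def abs_mult)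
  then have "9 * (sin h * \<bar>cos m\<bar>) = 9 / 2 * \<bar>sin q - sin p\<bar>" by simp
  also have "\<dots> \<le> 9 * \<epsilon>" using le by simp
  finally have "h\<^sup>2 \<le> 9 * \<epsilon>" .
  then have "h \<le> sqrt (9 * \<epsilon>)" by (rule real_le_rsqrt)
  then show ?case using le by (simp add: real_sqrt_mult h_def)
next
  case (sym p q)
  then show ?case by (simp add: abs_minus_commute)
qed

text \<open>The factor 2 comes from covering S by an interval centred at one of its own
  points.\<close>

lemma emeasure_lborel_le_of_diameter:
  fixes S :: "real set"
  assumes "0 \<le> d" "\<And>u v. u \<in> S \<Longrightarrow> v \<in> S \<Longrightarrow> \<bar>v - u\<bar> \<le> d"
  shows "emeasure lborel S \<le> ennreal (2 * d)"
proof (cases "S = {}")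
  case False
  then obtain u where "u \<in> S" by blast
  then have "S \<subseteq> {u - d..u + d}" using assms(2)[of u] by (force simp: abs_le_iff)
  then have "emeasure lborel S \<le> emeasure lborel {u - d..u + d}" by (intro emeasure_mono) auto
  then show ?thesis using assms(1) by simp
qed simp

text \<open>The window meets at most six monotone branches. On each, the angle varies by at most
  \<open>6 * sqrt \<epsilon>\<close>, hence w by at most \<open>sqrt \<epsilon>\<close> since 2 pi >
  6, which gives measure at most \<open>2 * sqrt \<epsilon>\<close>. The bound is uniform in b and
  c, so it can later be applied with values depending on the state of the chain.\<close>

lemma emeasure_sin_sublevel:
  fixes \<sigma> \<epsilon> b c :: real
  assumes "\<sigma> \<le> 1" "0 \<le> \<epsilon>"
  shows "emeasure lborel {w \<in> {-\<sigma>..\<sigma>}. \<bar>sin (2 * pi * (c + w)) - b\<bar> \<le> \<epsilon>}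
    \<le> ennreal (12 * sqrt \<epsilon>)"
proof -
  define S where "S k = {w \<in> {-\<sigma>..\<sigma>}. \<bar>sin (2 * pi * (c + w)) - b\<bar> \<le> \<epsilon> \<and>
    \<bar>2 * pi * (c + w) - pi * of_int k\<bar> \<le> pi / 2}" for k :: int
  \<comment> \<open>These six indices suffice because \<open>2 * w\<close> ranges within [-2, 2] and
    rounding to the nearest integer shifts by at most 1/2.\<close>
  define K where "K = {\<lfloor>2 * c\<rfloor> - 2..\<lfloor>2 * c\<rfloor> + 3}"
  have meas: "S k \<in> sets lborel" for k
    unfolding S_def by measurable
  have len: "emeasure lborel (S k) \<le> ennreal (2 * sqrt \<epsilon>)" for k
  proof (rule emeasure_lborel_le_of_diameter)
    fix u v assume "u \<in> S k" "v \<in> S k"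
    then have "\<bar>2 * pi * (c + v) - 2 * pi * (c + u)\<bar> \<le> 6 * sqrt \<epsilon>"
      by (intro sin_sublevel_diameter[where k = k and b = b]) (auto simp: S_def)
    also have "2 * pi * (c + v) - 2 * pi * (c + u) = 2 * pi * (v - u)"
      by (simp add: algebra_simps)
    finally have "2 * pi * \<bar>v - u\<bar> \<le> 6 * sqrt \<epsilon>" by (simp add: abs_mult)
    moreover have "6 * \<bar>v - u\<bar> \<le> 2 * pi * \<bar>v - u\<bar>"
      using pi_gt3 by (intro mult_right_mono) auto
    ultimately have "6 * \<bar>v - u\<bar> \<le> 6 * sqrt \<epsilon>" by (rule order_trans[rotated])
    then show "\<bar>v - u\<bar> \<le> sqrt \<epsilon>" by simp
  qed (use assms in auto)
  have "{w \<in> {-\<sigma>..\<sigma>}. \<bar>sin (2 * pi * (c + w)) - b\<bar> \<le> \<epsilon>} \<subseteq> (\<Union>k\<in>K. S k)"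
  proof
    fix w assume w: "w \<in> {w \<in> {-\<sigma>..\<sigma>}. \<bar>sin (2 * pi * (c + w)) - b\<bar> \<le> \<epsilon>}"
    \<comment> \<open>The integer nearest to \<open>2 * (c + w)\<close> names the branch that
      contains the angle.\<close>
    define k where "k = \<lfloor>2 * (c + w) + 1 / 2\<rfloor>"
    have wb: "-1 \<le> w" "w \<le> 1" using w assms(1) by auto
    have k: "of_int k \<le> 2 * (c + w) + 1 / 2" "2 * (c + w) + 1 / 2 < of_int k + 1"
      unfolding k_def by linarith+
    have kK: "k \<in> K" using wb k_def unfolding K_def by (auto; linarith)
    have "\<bar>2 * (c + w) - of_int k\<bar> \<le> 1 / 2" using k by linarith
    then have "\<bar>pi * (2 * (c + w) - of_int k)\<bar> \<le> pi * (1 / 2)"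
      unfolding abs_mult by (intro mult_mono) auto
    then show "w \<in> (\<Union>k\<in>K. S k)" using w kK by (auto simp: S_def algebra_simps)
  qed
  then have "emeasure lborel {w \<in> {-\<sigma>..\<sigma>}. \<bar>sin (2 * pi * (c + w)) - b\<bar> \<le> \<epsilon>}
      \<le> emeasure lborel (\<Union>k\<in>K. S k)"
    using meas by (intro emeasure_mono) (auto simp: K_def)
  also have "\<dots> \<le> (\<Sum>k\<in>K. emeasure lborel (S k))"
    using meas by (intro emeasure_subadditive_finite) (auto simp: K_def)
  also have "\<dots> \<le> (\<Sum>k\<in>K. ennreal (2 * sqrt \<epsilon>))" using len by (intro sum_mono) auto
  also have "\<dots> = ennreal (12 * sqrt \<epsilon>)"
    using assms(2) by (simp add: K_def flip: ennreal_mult' ennreal_numeral)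
  finally show ?thesis .
qed

section \<open>Stationary measures\<close>

text \<open>The left side is either the right side or the default value 0 of an ill-formed measure.
  Upper bounds on the kernel can therefore be read off from the noise directly.\<close>

lemma emeasure_distr_le: "emeasure (distr M N f) A \<le> emeasure M (f -` A \<inter> space M)"
  unfolding distr_def emeasure_measure_of_conv by auto

lemma prob_space_noise: "L > 0 \<Longrightarrow> prob_space (noise \<delta> L)"
  unfolding noise_def by (intro prob_space_uniform_measure) auto

lemma stationary_emeasure_le:
  assumes "stationary_inv_proj \<delta> L \<nu>" "A \<in> sets proj_bundle"
    and "\<And>z. z \<in> space proj_bundle \<Longrightarrow>
      emeasure (noise \<delta> L) {w. inv_proj_step L w z \<in> A} \<le> g z"
  shows "emeasure \<nu> A \<le> (\<integral>\<^sup>+ z. g z \<partial>\<nu>)"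
proof -
  have sp: "space \<nu> = space proj_bundle"
    using assms(1) by (intro sets_eq_imp_space_eq) (simp add: stationary_inv_proj_def)
  have "emeasure \<nu> A = (\<integral>\<^sup>+ z. emeasure (inv_proj_kernel \<delta> L z) A \<partial>\<nu>)"
    using assms by (simp add: stationary_inv_proj_def)
  also have "\<dots> \<le> (\<integral>\<^sup>+ z. g z \<partial>\<nu>)"
  proof (rule nn_integral_mono)
    fix z assume "z \<in> space \<nu>"
    then have g: "emeasure (noise \<delta> L) {w. inv_proj_step L w z \<in> A} \<le> g z"
      using assms(3) sp by simp
    show "emeasure (inv_proj_kernel \<delta> L z) A \<le> g z"
      unfolding inv_proj_kernel_def
      by (rule order_trans[OF emeasure_distr_le]) (use g in \<open>simp add: noise_def vimage_def\<close>)
  qed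
  finally show ?thesis .
qed

text \<open>For the steps in which the noise is not exploited: outside C no kick leads into A, so
  the indicator of C dominates the transition probability.\<close>

lemma stationary_emeasure_le_preimage:
  assumes "L > 0" "stationary_inv_proj \<delta> L \<nu>" "A \<in> sets proj_bundle" "C \<in> sets proj_bundle"
    and "\<And>z w. z \<in> space proj_bundle \<Longrightarrow> inv_proj_step L w z \<in> A \<Longrightarrow> z \<in> C"
  shows "emeasure \<nu> A \<le> emeasure \<nu> C"
proof -
  interpret prob_space "noise \<delta> L" by (rule prob_space_noise[OF assms(1)])
  have "emeasure \<nu> A \<le> (\<integral>\<^sup>+ z. indicator C z \<partial>\<nu>)"
  proof (rule stationary_emeasure_le[OF assms(2,3)])
    fix z assume z: "z \<in> space proj_bundle"
    show "emeasure (noise \<delta> L) {w. inv_proj_step L w z \<in> A} \<le> indicator C z"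
    proof (cases "z \<in> C")
      case False
      then have "{w. inv_proj_step L w z \<in> A} = {}" using assms(5)[OF z] by blast
      then show ?thesis by simp
    qed (simp add: emeasure_le_1)
  qed
  also have "\<dots> = emeasure \<nu> C"
    using assms(2,4) by (intro nn_integral_indicator) (auto simp: stationary_inv_proj_def)
  finally show ?thesis .
qed

text \<open>For the step in which the noise is exploited: a bound uniform in the starting state
  survives averaging over the probability measure.\<close>

lemma stationary_emeasure_le_const:
  assumes "stationary_inv_proj \<delta> L \<nu>" "A \<in> sets proj_bundle"
    and "\<And>z. z \<in> space proj_bundle \<Longrightarrow>
      emeasure (noise \<delta> L) {w. inv_proj_step L w z \<in> A} \<le> p"
  shows "emeasure \<nu> A \<le> p"
proof -
  interpret prob_space \<nu> using assms(1) by (simp add: stationary_inv_proj_def)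
  show ?thesis
    using stationary_emeasure_le[OF assms(1,2), of "\<lambda>_. p"] assms(3) by (simp add: emeasure_space_1)
qed

section \<open>The projective step\<close>

lemma Collect_in_sets_proj_bundle:
  assumes "Measurable.pred (borel \<Otimes>\<^sub>M borel \<Otimes>\<^sub>M borel)
    (\<lambda>z. P (fst z) (fst (snd z)) (snd (snd z)))"
  shows "{(x, y, t) \<in> space proj_bundle. P x y t} \<in> sets proj_bundle"
proof -
  have "{(x, y, t) \<in> space proj_bundle. P x y t}
      = ({0..<1} \<times> {0..<1} \<times> {0..<pi}) \<inter> {(x, y, t). P x y t}"
    by (auto simp: proj_bundle_def space_restrict_space)
  moreover have "{(x, y, t). P x y t} \<in> sets borel"
    using assms unfolding borel_prod by (simp add: pred_def case_prod_unfold)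
  ultimately show ?thesis
    unfolding proj_bundle_def sets_restrict_space by blast
qed

lemma deriv_kick: "deriv (kick L) y = - (2 * pi * L * sin (2 * pi * y))"
proof -
  have "(kick L has_field_derivative L * (- sin (2 * pi * y) * (2 * pi))) (at y)"
    unfolding kick_def by (auto intro!: derivative_eq_intros)
  then show ?thesis by (simp add: DERIV_imp_deriv)
qed

lemma deriv_kick_frac: "deriv (kick L) (frac y) = deriv (kick L) y"
proof -
  have "2 * pi * frac y = 2 * pi * y - 2 * pi * of_int \<lfloor>y\<rfloor>"
    by (simp add: frac_def right_diff_distrib)
  then show ?thesis by (simp add: deriv_kick sin_diff)
qed

text \<open>The scalar c expresses the angle recursion in homogeneous form, which covers the
  horizontal direction, where the cotangent is infinite. Having t' fixed before w records that the
  new angle and the new y are independent of the current kick.\<close>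

lemma inv_proj_step_eq:
  assumes "(x, y, t) \<in> space proj_bundle"
  obtains t' c where
    "\<forall>w. inv_proj_step L w (x, y, t) = (frac (y - w), frac (kick L y - x), t')"
    "c \<noteq> 0" "sin t = c * cos t'" "deriv (kick L) y * sin t - cos t = c * sin t'"
proof -
  define v where "v = perturbed_map_inv_deriv L (x, y) (cos t, sin t)"
  have v: "v = (sin t, deriv (kick L) y * sin t - cos t)"
    by (simp add: v_def perturbed_map_inv_deriv_def)
  have "v \<noteq> 0"
  proof
    assume "v = 0"
    then have "sin t = 0" "cos t = 0" by (auto simp: v zero_prod_def)
    then show False using sin_cos_squared_add[of t] by simp
  qed
  then obtain c where c: "c \<noteq> 0" "v = c *\<^sub>R (cos (line_angle v), sin (line_angle v))"
    using line_angle_exists by blast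
  have "fst v = c * cos (line_angle v)" "snd v = c * sin (line_angle v)"
    by (subst c(2), simp)+
  then have "sin t = c * cos (line_angle v)"
    "deriv (kick L) y * sin t - cos t = c * sin (line_angle v)"
    unfolding v by simp_all
  moreover have "\<forall>w. inv_proj_step L w (x, y, t) = (frac (y - w), frac (kick L y - x), line_angle v)"
    by (simp add: inv_proj_step_def perturbed_map_inv_def v_def)
  ultimately show thesis using that c(1) by blast
qed

section \<open>Probability that the derivative of the kick lies in a given window\<close>

lemma emeasure_noise_deriv_kick_sublevel:
  assumes "L \<ge> 1" "\<delta> > 0" "M \<ge> 0"
  shows "emeasure (noise \<delta> L) {w. \<bar>deriv (kick L) (c + w) - a\<bar> \<le> M}
    \<le> ennreal (6 * sqrt (M / L) * L powr \<delta>)"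
proof -
  define \<sigma> where "\<sigma> = L powr (-\<delta>)"
  define A where "A = {w. \<bar>deriv (kick L) (c + w) - a\<bar> \<le> M}"
  \<comment> \<open>With this b, \<open>deriv (kick L) (c + w) - a\<close> equals -2 pi L times
    \<open>sin (2 * pi * (c + w)) - b\<close>.\<close>
  define b where "b = - a / (2 * pi * L)"
  have \<sigma>: "0 < \<sigma>" "\<sigma> \<le> 1"
    using assms powr_mono[of "-\<delta>" 0 L] by (auto simp: \<sigma>_def)
  have A: "A \<in> sets lborel" unfolding A_def deriv_kick by measurable
  have "{-\<sigma>..\<sigma>} \<inter> A \<subseteq> {w \<in> {-\<sigma>..\<sigma>}. \<bar>sin (2 * pi * (c + w)) - b\<bar> \<le> M / L}"
  proof
    fix w assume w: "w \<in> {-\<sigma>..\<sigma>} \<inter> A"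
    have "L * \<bar>sin (2 * pi * (c + w)) - b\<bar> \<le> 2 * pi * L * \<bar>sin (2 * pi * (c + w)) - b\<bar>"
      using assms pi_gt3 by (intro mult_right_mono) auto
    also have "\<dots> = \<bar>2 * pi * L * (sin (2 * pi * (c + w)) - b)\<bar>"
      using assms by (simp add: abs_mult)
    also have "2 * pi * L * (sin (2 * pi * (c + w)) - b) = - (deriv (kick L) (c + w) - a)"
      using assms by (simp add: deriv_kick b_def field_simps)
    also have "\<bar>\<dots>\<bar> \<le> M" using w by (simp add: A_def abs_minus_commute)
    finally show "w \<in> {w \<in> {-\<sigma>..\<sigma>}. \<bar>sin (2 * pi * (c + w)) - b\<bar> \<le> M / L}"
      using w assms by (simp add: field_simps)
  qed
  then have "emeasure lborel ({-\<sigma>..\<sigma>} \<inter> A)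
      \<le> emeasure lborel {w \<in> {-\<sigma>..\<sigma>}. \<bar>sin (2 * pi * (c + w)) - b\<bar> \<le> M / L}"
    by (rule emeasure_mono) measurable
  also have "\<dots> \<le> ennreal (12 * sqrt (M / L))"
    using \<sigma> assms by (intro emeasure_sin_sublevel) auto
  \<comment> \<open>Normalising by the length of the noise interval produces the loss
    \<open>L powr \<delta>\<close>.\<close>
  finally have "emeasure lborel ({-\<sigma>..\<sigma>} \<inter> A) / ennreal (2 * \<sigma>)
      \<le> ennreal (12 * sqrt (M / L)) / ennreal (2 * \<sigma>)"
    by (rule divide_right_mono_ennreal)
  also have "\<dots> = ennreal (12 * sqrt (M / L) / (2 * \<sigma>))"
    using \<sigma>(1) assms by (intro divide_ennreal) auto
  also have "12 * sqrt (M / L) / (2 * \<sigma>) = 6 * sqrt (M / L) * L powr \<delta>"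
    by (simp add: \<sigma>_def powr_minus_divide)
  finally show ?thesis
    using A \<sigma> unfolding noise_def A_def[symmetric] \<sigma>_def[symmetric]
    by simp
qed

section \<open>Directions away from the vertical\<close>

text \<open>Let d be the distance of t to pi/2. Sine and cosine swap roles under this shift, and
  \<open>d * cos d \<le> sin d\<close> turns a lower bound on d into an upper bound on the slope,
  again without division.\<close>

lemma far_from_vertical_imp:
  assumes "t \<in> {0..<pi}" "t \<notin> proj_ball r (pi / 2)"
  shows "r * \<bar>sin t\<bar> \<le> \<bar>cos t\<bar>"
proof -
  define d where "d = \<bar>t - pi / 2\<bar>"
  have d: "0 \<le> d" "d \<le> pi / 2" using assms(1) by (auto simp: d_def abs_if)
  have "proj_dist t (pi / 2) = d" using d by (simp add: proj_dist_def d_def)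
  then have "r \<le> d" using assms by (auto simp: proj_ball_def)
  have c: "cos d = \<bar>sin t\<bar>" "sin d = \<bar>cos t\<bar>"
    using assms(1) sin_ge_zero[of t] cos_ge_zero[of t] cos_ge_zero[of "pi - t"]
    by (auto simp: d_def abs_if cos_diff sin_diff)
  have "r * cos d \<le> d * cos d" using \<open>r \<le> d\<close> d by (intro mult_right_mono cos_ge_zero) auto
  also have "\<dots> \<le> sin d" using d by (intro mult_cos_le_sin) auto
  finally show ?thesis by (simp add: c)
qed

lemma emeasure_stationary_near_horizontal:
  assumes "L \<ge> 1" "\<delta> > 0" "M \<ge> 0" "stationary_inv_proj \<delta> L \<nu>"
  shows "emeasure \<nu> {(x, y, t) \<in> space proj_bundle. \<bar>sin t\<bar> \<le> M * \<bar>cos t\<bar>}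
    \<le> ennreal (6 * sqrt (M / L) * L powr \<delta>)"
proof -
  \<comment> \<open>The three sets say that the tangent of the angle now, after one step, and after
    two steps is at most M in absolute value, each in terms of the current state and with
    denominators cleared. Starting one step before \<open>B\<^sub>3\<close> makes the noise
    visible.\<close>
  define B\<^sub>1 where "B\<^sub>1 = {(x, y, t) \<in> space proj_bundle. \<bar>sin t\<bar> \<le> M * \<bar>cos t\<bar>}"
  define B\<^sub>2 where "B\<^sub>2 = {(x, y, t) \<in> space proj_bundle.
    sin t \<noteq> 0 \<and> \<bar>deriv (kick L) y * sin t - cos t\<bar> \<le> M * \<bar>sin t\<bar>}"
  define B\<^sub>3 where "B\<^sub>3 = {(x, y, t) \<in> space proj_bundle.
    deriv (kick L) y * sin t - cos t \<noteq> 0 \<and>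
    \<bar>deriv (kick L) (kick L y - x) * (deriv (kick L) y * sin t - cos t) - sin t\<bar>
      \<le> M * \<bar>deriv (kick L) y * sin t - cos t\<bar>}"
  have B: "B\<^sub>1 \<in> sets proj_bundle" "B\<^sub>2 \<in> sets proj_bundle" "B\<^sub>3 \<in> sets proj_bundle"
  proof -
    show "B\<^sub>1 \<in> sets proj_bundle"
      unfolding B\<^sub>1_def by (rule Collect_in_sets_proj_bundle) measurable
    show "B\<^sub>2 \<in> sets proj_bundle"
      unfolding B\<^sub>2_def deriv_kick by (rule Collect_in_sets_proj_bundle) measurable
    define v where
      "v = (\<lambda>z :: real \<times> real \<times> real.
        deriv (kick L) (fst (snd z)) * sin (snd (snd z)) - cos (snd (snd z)))"
    define D where
      "D = (\<lambda>z :: real \<times> real \<times> real. deriv (kick L) (kick L (fst (snd z)) - fst z))"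
    have [measurable]: "v \<in> borel_measurable (borel \<Otimes>\<^sub>M borel \<Otimes>\<^sub>M borel)"
      unfolding v_def deriv_kick by measurable
    have [measurable]: "D \<in> borel_measurable (borel \<Otimes>\<^sub>M borel \<Otimes>\<^sub>M borel)"
      unfolding D_def deriv_kick kick_def by measurable
    have "Measurable.pred (borel \<Otimes>\<^sub>M borel \<Otimes>\<^sub>M borel)
        (\<lambda>z. v z \<noteq> 0 \<and> \<bar>D z * v z - sin (snd (snd z))\<bar> \<le> M * \<bar>v z\<bar>)"
      by measurable
    then show "B\<^sub>3 \<in> sets proj_bundle"
      unfolding B\<^sub>3_def v_def D_def by (rule Collect_in_sets_proj_bundle)
  qed
  have L: "L > 0" using assms(1) by simp
  have "emeasure \<nu> B\<^sub>1 \<le> emeasure \<nu> B\<^sub>2"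
  proof (rule stationary_emeasure_le_preimage[OF L assms(4) B(1,2)])
    fix z w assume z: "z \<in> space proj_bundle" and st: "inv_proj_step L w z \<in> B\<^sub>1"
    obtain x y t where zz: "z = (x, y, t)" by (cases z)
    have z': "(x, y, t) \<in> space proj_bundle" using z zz by simp
    obtain t' c where e:
      "\<forall>w. inv_proj_step L w (x, y, t) = (frac (y - w), frac (kick L y - x), t')"
      "c \<noteq> 0" "sin t = c * cos t'" "deriv (kick L) y * sin t - cos t = c * sin t'"
      by (rule inv_proj_step_eq[OF z', where L = L])
    have b: "\<bar>sin t'\<bar> \<le> M * \<bar>cos t'\<bar>" using st by (simp add: zz e(1) B\<^sub>1_def)
    have "cos t' \<noteq> 0" using b sin_zero_abs_cos_one[of t'] by auto
    \<comment> \<open>Scaling by c replaces the new sine and cosine by expressions in the old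
      state.\<close>
    moreover have "\<bar>c * sin t'\<bar> \<le> M * \<bar>c * cos t'\<bar>"
      using mult_left_mono[OF b, of "\<bar>c\<bar>"] by (simp add: abs_mult algebra_simps)
    ultimately show "z \<in> B\<^sub>2"
      using z' e(2) by (simp only: zz B\<^sub>2_def mem_Collect_eq case_prod_conv e(4)) (simp add: e(3))
  qed
  also have "\<dots> \<le> emeasure \<nu> B\<^sub>3"
  proof (rule stationary_emeasure_le_preimage[OF L assms(4) B(2,3)])
    fix z w assume z: "z \<in> space proj_bundle" and st: "inv_proj_step L w z \<in> B\<^sub>2"
    obtain x y t where zz: "z = (x, y, t)" by (cases z)
    have z': "(x, y, t) \<in> space proj_bundle" using z zz by simp
    obtain t' c where e:
      "\<forall>w. inv_proj_step L w (x, y, t) = (frac (y - w), frac (kick L y - x), t')"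
      "c \<noteq> 0" "sin t = c * cos t'" "deriv (kick L) y * sin t - cos t = c * sin t'"
      by (rule inv_proj_step_eq[OF z', where L = L])
    define D where "D = deriv (kick L) (kick L y - x)"
    have b: "sin t' \<noteq> 0" "\<bar>D * sin t' - cos t'\<bar> \<le> M * \<bar>sin t'\<bar>"
      using st by (auto simp: zz e(1) B\<^sub>2_def deriv_kick_frac D_def)
    have "\<bar>D * (c * sin t') - c * cos t'\<bar> = \<bar>c\<bar> * \<bar>D * sin t' - cos t'\<bar>"
      by (simp add: abs_mult[symmetric] algebra_simps)
    also have "\<dots> \<le> M * \<bar>c * sin t'\<bar>"
      using mult_left_mono[OF b(2), of "\<bar>c\<bar>"] by (simp add: abs_mult algebra_simps)
    finally show "z \<in> B\<^sub>3"
      using z' e(2) b(1)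
      by (simp only: zz B\<^sub>3_def mem_Collect_eq case_prod_conv e(4) D_def[symmetric])
        (simp add: e(3))
  qed
  also have "\<dots> \<le> ennreal (6 * sqrt (M / L) * L powr \<delta>)"
  proof (rule stationary_emeasure_le_const[OF assms(4) B(3)])
    fix z assume z: "z \<in> space proj_bundle"
    obtain x y t where zz: "z = (x, y, t)" by (cases z)
    have z': "(x, y, t) \<in> space proj_bundle" using z zz by simp
    \<comment> \<open>Only the first coordinate depends on w. It enters \<open>B\<^sub>3\<close>
      through \<open>kick L y - x\<close>, the next y modulo 1.\<close>
    obtain y' t' where e: "\<forall>w. inv_proj_step L w z = (frac (y - w), y', t')"
      unfolding zz by (rule inv_proj_step_eq[OF z', where L = L]) blast
    \<comment> \<open>The quotient \<open>sin t' / v\<close> is the cotangent of the angle one step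
      later. It does not depend on w, so it can act as the fixed centre of the window.\<close>
    define v where "v = deriv (kick L) y' * sin t' - cos t'"
    have "{w. inv_proj_step L w z \<in> B\<^sub>3}
        \<subseteq> {w. \<bar>deriv (kick L) (kick L y' - y + w) - sin t' / v\<bar> \<le> M}"
    proof
      fix w assume "w \<in> {w. inv_proj_step L w z \<in> B\<^sub>3}"
      then have *: "v \<noteq> 0"
        "\<bar>deriv (kick L) (kick L y' - frac (y - w)) * v - sin t'\<bar> \<le> M * \<bar>v\<bar>"
        by (auto simp: e B\<^sub>3_def v_def)
      define D where "D = deriv (kick L) (kick L y' - y + w)"
      \<comment> \<open>Periodicity of the derivative removes both reductions modulo 1, leaving a
        translate of the uniform variable w.\<close>
      have "deriv (kick L) (kick L y' - frac (y - w))
          = deriv (kick L) (frac (kick L y' - frac (y - w)))"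
        by (simp add: deriv_kick_frac)
      also have "\<dots> = D" by (simp add: frac_diff_frac deriv_kick_frac D_def algebra_simps)
      finally have "\<bar>D * v - sin t'\<bar> \<le> M * \<bar>v\<bar>" using * by simp
      moreover have "D * v - sin t' = (D - sin t' / v) * v" using * by (simp add: field_simps)
      ultimately show "w \<in> {w. \<bar>deriv (kick L) (kick L y' - y + w) - sin t' / v\<bar> \<le> M}"
        using * by (simp add: abs_mult D_def)
    qed
    then have "emeasure (noise \<delta> L) {w. inv_proj_step L w z \<in> B\<^sub>3}
        \<le> emeasure (noise \<delta> L) {w. \<bar>deriv (kick L) (kick L y' - y + w) - sin t' / v\<bar> \<le> M}"
      by (rule emeasure_mono) (simp add: noise_def deriv_kick, measurable)
    also have "\<dots> \<le> ennreal (6 * sqrt (M / L) * L powr \<delta>)"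
      by (rule emeasure_noise_deriv_kick_sublevel[OF assms(1-3)])
    finally show "emeasure (noise \<delta> L) {w. inv_proj_step L w z \<in> B\<^sub>3} \<le> \<dots>" .
  qed
  finally show ?thesis by (simp add: B\<^sub>1_def)
qed

section \<open>Choice of the exponents\<close>

theorem proposition6p3:
  "\<exists>\<delta>\<^sub>0::real. \<delta>\<^sub>0 > 0 \<and> (\<forall>\<delta>. 0 < \<delta> \<and> \<delta> < \<delta>\<^sub>0 \<longrightarrow>
     (\<exists>s r :: real. s > 0 \<and> r > 0 \<and>
       (\<forall>\<^sub>F L :: real in at_top. \<forall>\<nu>. stationary_inv_proj \<delta> L \<nu> \<longrightarrow>
          measure \<nu> {(x, y, \<theta>) \<in> space \<nu>. \<theta> \<notin> proj_ball (L powr (-s)) (pi / 2)}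
            \<le> L powr (-r))))"
proof (rule exI[of _ "1 / 4 :: real"], intro conjI allI impI)
  fix \<delta> :: real
  assume \<delta>: "0 < \<delta> \<and> \<delta> < 1 / 4"
  have bound: "measure \<nu> {(x, y, \<theta>) \<in> space \<nu>. \<theta> \<notin> proj_ball (L powr (-(1 / 4))) (pi / 2)}
      \<le> L powr (-(1 / 16))"
    if st: "stationary_inv_proj \<delta> L \<nu>" and L: "L \<ge> 1" "L powr (1 / 16) \<ge> 6" for L \<nu>
  proof -
    interpret prob_space \<nu> using st by (simp add: stationary_inv_proj_def)
    have sp: "space \<nu> = space proj_bundle"
      using st by (intro sets_eq_imp_space_eq) (simp add: stationary_inv_proj_def)
    \<comment> \<open>M is the reciprocal of the ball radius, so directions outside the ball have
      slope at most M.\<close>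
    define M where "M = L powr (1 / 4)"
    define B where "B = {(x, y, t) \<in> space proj_bundle. \<bar>sin t\<bar> \<le> M * \<bar>cos t\<bar>}"
    have "emeasure \<nu> {(x, y, \<theta>) \<in> space \<nu>. \<theta> \<notin> proj_ball (L powr (-(1 / 4))) (pi / 2)}
        \<le> emeasure \<nu> B"
    proof (rule emeasure_mono)
      show "{(x, y, \<theta>) \<in> space \<nu>. \<theta> \<notin> proj_ball (L powr (-(1 / 4))) (pi / 2)} \<subseteq> B"
      proof clarify
        fix x y t
        assume z: "(x, y, t) \<in> space \<nu>" and t: "t \<notin> proj_ball (L powr (-(1 / 4))) (pi / 2)"
        have "t \<in> {0..<pi}" using z by (auto simp: sp proj_bundle_def space_restrict_space)
        from far_from_vertical_imp[OF this t]
        have "M * (L powr (-(1 / 4)) * \<bar>sin t\<bar>) \<le> M * \<bar>cos t\<bar>"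
          by (rule mult_left_mono) (simp add: M_def)
        moreover have "M * (L powr (-(1 / 4)) * \<bar>sin t\<bar>) = \<bar>sin t\<bar>"
          using L by (simp add: M_def mult.assoc[symmetric] powr_add[symmetric])
        ultimately show "(x, y, t) \<in> B" using z by (simp add: B_def sp)
      qed
      have "B \<in> sets proj_bundle"
        unfolding B_def by (intro Collect_in_sets_proj_bundle) measurable
      then show "B \<in> sets \<nu>" using st by (simp add: stationary_inv_proj_def)
    qed
    also have "\<dots> \<le> ennreal (6 * sqrt (M / L) * L powr \<delta>)"
      unfolding B_def using L \<delta> st
      by (intro emeasure_stationary_near_horizontal) (auto simp: M_def)
    also have "\<dots> \<le> ennreal (L powr (-(1 / 16)))"
    proof (rule ennreal_leI)
      \<comment> \<open>The estimate becomes \<open>6 * L powr (\<delta> - 3 / 8)\<close>. Since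
        \<delta> is below 1/4 the exponent is at most -1/8; half of this decay absorbs the factor 6,
        and the other half gives the exponent -1/16.\<close>
      have "M / L = L powr (-(3 / 4))"
        using L powr_diff[of L "1 / 4" 1] by (simp add: M_def)
      then have "sqrt (M / L) = L powr (-(3 / 8))"
        using L by (simp add: powr_half_sqrt[symmetric] powr_powr)
      then have "6 * sqrt (M / L) * L powr \<delta> = 6 * L powr (\<delta> - 3 / 8)"
        using L by (simp add: powr_add[symmetric] algebra_simps)
      also have "\<dots> \<le> L powr (1 / 16) * L powr (- (1 / 8))"
        using L \<delta> by (intro mult_mono powr_mono) auto
      also have "\<dots> = L powr (-(1 / 16))" by (simp add: powr_add[symmetric])
      finally show "6 * sqrt (M / L) * L powr \<delta> \<le> L powr (-(1 / 16))" .
    qed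
    finally show ?thesis by (simp add: emeasure_eq_measure)
  qed
  have "filterlim (\<lambda>L :: real. L powr (1 / 16)) at_top at_top"
    by real_asymp
  then have "\<forall>\<^sub>F L :: real in at_top. L powr (1 / 16) \<ge> 6" by (simp add: filterlim_at_top)
  then have "\<forall>\<^sub>F L :: real in at_top. \<forall>\<nu>. stationary_inv_proj \<delta> L \<nu> \<longrightarrow>
      measure \<nu> {(x, y, \<theta>) \<in> space \<nu>. \<theta> \<notin> proj_ball (L powr (-(1 / 4))) (pi / 2)}
        \<le> L powr (-(1 / 16))"
    using eventually_ge_at_top[of "1 :: real"] by eventually_elim (use bound in blast)
  then show "\<exists>s r :: real. s > 0 \<and> r > 0 \<and>
      (\<forall>\<^sub>F L :: real in at_top. \<forall>\<nu>. stationary_inv_proj \<delta> L \<nu> \<longrightarrow>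
        measure \<nu> {(x, y, \<theta>) \<in> space \<nu>. \<theta> \<notin> proj_ball (L powr (-s)) (pi / 2)}
          \<le> L powr (-r))"
    by (intro exI[of _ "1 / 4"] exI[of _ "1 / 16"]) simp
qed simp

end
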